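(* Let $\gamma$ be an ordinal, let $A$ be a set, and let $X\subseteq{}^{\gamma}A$ (with the bounded topology). If $X$ has weight $\lambda$, then it contains a family of pairwise disjoint basic clopen sets of size $\lambda$. In particular, $c(X)=d(X)=w(X)$, where $c$, $d$, $w$ denote cellularity, density and weight.
   Context: ${}^{\gamma}A$ is the set of sequences of elements of $A$ of length $\gamma$, with the bounded topology, generated by the cones $\mathbf{N}_s=\{x\in{}^{\gamma}A\mid s\subseteq x\}$ for $s\in{}^{<\gamma}A=\bigcup_{\alpha<\gamma}{}^{\alpha}A$. Subsets $X$ carry the subspace topology. The basic clopen sets of $X$ are the members of its canonical basis $\mathcal{B}(X)=\{\mathbf{N}_s\cap X\mid s\in{}^{<\gamma}A,\ \mathbf{N}_s\cap X\neq\emptyset\}$. The weight is the minimal size of a basis; the density is the minimal size of a dense subset; the cellularity is the minimal cardinal $\delta$ such that every family of pairwise disjoint (non-empty) open sets has size at most $\delta$.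
   Formalization: The claim about the family of pairwise disjoint basic clopen sets excludes the case γ = 0 with X nonempty, where the canonical basis is empty although the one-point space X has weight 1; c(X)=d(X)=w(X) is proved for all γ. *)

theory Defs
  imports "HOL-Analysis.Analysis"
begin

unbundle cardinal_syntax
no_notation elt_set_eq  (infix \<open>=o\<close> 50)

section \<open>Sequences of ordinal length and the bounded topology\<close>

text \<open>
  An ordinal \<open>\<gamma>\<close> is given by a well-order \<open>r\<close>, i.e. \<open>Well_order r\<close>, and its elements are those of
  \<open>Field r\<close>; \<open>\<gamma> = 0\<close> corresponds to \<open>Field r = {}\<close>. The ordinals \<open>\<alpha> < \<gamma>\<close> are, up to isomorphism,
  exactly the proper initial segments \<open>underS r i\<close> with \<open>i \<in> Field r\<close>.

  Sequences are partial functions, so that the relation ``\<open>s \<subseteq> x\<close>'' between sequences is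
  \<open>s \<subseteq>\<^sub>m x\<close> and the length of a sequence is determined by its domain.
\<close>

definition seqs :: "'i set \<Rightarrow> 'a set \<Rightarrow> ('i \<rightharpoonup> 'a) set" where
  "seqs I A = {x. dom x = I \<and> ran x \<subseteq> A}"

definition seqs_below :: "'i rel \<Rightarrow> 'a set \<Rightarrow> ('i \<rightharpoonup> 'a) set" where
  "seqs_below r A = (\<Union>i\<in>Field r. seqs (underS r i) A)"

definition seq_cone :: "'i rel \<Rightarrow> 'a set \<Rightarrow> ('i \<rightharpoonup> 'a) \<Rightarrow> ('i \<rightharpoonup> 'a) set" where
  "seq_cone r A s = {x \<in> seqs (Field r) A. s \<subseteq>\<^sub>m x}"

text \<open>
  The topology on \<open>seqs (Field r) A\<close> generated by the cones. The underlying space of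
  \<^const>\<open>topology_generated_by\<close> is the union of the generators. If \<open>\<gamma> \<noteq> 0\<close> the whole space is the cone
  of the empty sequence, so inserting it only matters for \<open>\<gamma> = 0\<close>, where there are no cones
  but the space has one point.
\<close>

definition bounded_topology :: "'i rel \<Rightarrow> 'a set \<Rightarrow> ('i \<rightharpoonup> 'a) topology" where
  "bounded_topology r A =
     topology_generated_by (insert (seqs (Field r) A) (seq_cone r A ` seqs_below r A))"

definition canonical_basis :: "'i rel \<Rightarrow> 'a set \<Rightarrow> ('i \<rightharpoonup> 'a) set \<Rightarrow> ('i \<rightharpoonup> 'a) set set" where
  "canonical_basis r A X =
     {seq_cone r A s \<inter> X | s. s \<in> seqs_below r A \<and> seq_cone r A s \<inter> X \<noteq> {}}"

section \<open>Weight, density and cellularity\<close>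

text \<open>
  Cardinals are cardinal orders, considered up to \<open>=o\<close>. No infinite lower bound is imposed on
  the cardinal functions: they may be finite.
\<close>

definition least_card :: "'k rel set \<Rightarrow> 'k rel" where
  "least_card K = (SOME k. k \<in> K \<and> (\<forall>k'\<in>K. k \<le>o k'))"

lemma least_card:
  assumes "K \<noteq> {}" and "\<And>k. k \<in> K \<Longrightarrow> Card_order k"
  shows "least_card K \<in> K" and "\<And>k'. k' \<in> K \<Longrightarrow> least_card K \<le>o k'"
proof -
  have "\<exists>k. k \<in> K \<and> (\<forall>k'\<in>K. k \<le>o k')"
    using exists_minim_Card_order[of K] assms by blast
  from someI_ex[OF this] show "least_card K \<in> K" and "\<And>k'. k' \<in> K \<Longrightarrow> least_card K \<le>o k'"
    unfolding least_card_def by blast+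
qed

definition is_base :: "'p topology \<Rightarrow> 'p set set \<Rightarrow> bool" where
  "is_base T B \<longleftrightarrow> (\<forall>V\<in>B. openin T V) \<and>
     (\<forall>U x. openin T U \<and> x \<in> U \<longrightarrow> (\<exists>V\<in>B. x \<in> V \<and> V \<subseteq> U))"

definition is_dense :: "'p topology \<Rightarrow> 'p set \<Rightarrow> bool" where
  "is_dense T D \<longleftrightarrow> D \<subseteq> topspace T \<and> T closure_of D = topspace T"

definition cellular_family :: "'p topology \<Rightarrow> 'p set set \<Rightarrow> bool" where
  "cellular_family T F \<longleftrightarrow> (\<forall>U\<in>F. openin T U \<and> U \<noteq> {}) \<and> pairwise disjnt F"

definition top_weight :: "'p topology \<Rightarrow> 'p set rel" where
  "top_weight T = least_card {|B| | B. is_base T B}"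

definition top_density :: "'p topology \<Rightarrow> 'p rel" where
  "top_density T = least_card {|D| | D. is_dense T D}"

text \<open>
  Restricting the bounds \<open>\<delta>\<close> to cardinals on the type \<^typ>\<open>'p set\<close> loses nothing: the cardinality of
  that type is itself a bound, so every smaller bound is isomorphic to a cardinal on it.
\<close>

definition top_cellularity :: "'p topology \<Rightarrow> 'p set rel" where
  "top_cellularity T =
     least_card {\<delta>. Card_order \<delta> \<and> (\<forall>F. cellular_family T F \<longrightarrow> |F| \<le>o \<delta>)}"

lemma top_weight:
  shows "\<exists>B. is_base T B \<and> top_weight T = |B|" and "is_base T B \<Longrightarrow> top_weight T \<le>o |B|"
proof -
  let ?K = "{|B| | B. is_base T B}"
  have "is_base T {U. openin T U}"
    unfolding is_base_def by blast
  then have ne: "?K \<noteq> {}" by blast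
  have co: "Card_order k" if "k \<in> ?K" for k
    using that card_of_Card_order by blast
  show "\<exists>B. is_base T B \<and> top_weight T = |B|"
    using least_card(1)[OF ne co] unfolding top_weight_def by blast
  show "top_weight T \<le>o |B|" if "is_base T B"
    unfolding top_weight_def by (rule least_card(2)[OF ne co]) (use that in blast)+
qed

lemma top_density:
  shows "\<exists>D. is_dense T D \<and> top_density T = |D|" and "is_dense T D \<Longrightarrow> top_density T \<le>o |D|"
proof -
  let ?K = "{|D| | D. is_dense T D}"
  have "is_dense T (topspace T)"
    unfolding is_dense_def by simp
  then have ne: "?K \<noteq> {}" by blast
  have co: "Card_order k" if "k \<in> ?K" for k
    using that card_of_Card_order by blast
  show "\<exists>D. is_dense T D \<and> top_density T = |D|"
    using least_card(1)[OF ne co] unfolding top_density_def by blast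
  show "top_density T \<le>o |D|" if "is_dense T D"
    unfolding top_density_def by (rule least_card(2)[OF ne co]) (use that in blast)+
qed

lemma top_cellularity:
  fixes T :: "'p topology" and \<delta> :: "'k rel"
  shows "Card_order (top_cellularity T)"
    and "cellular_family T F \<Longrightarrow> |F| \<le>o top_cellularity T"
    and "\<lbrakk>Card_order \<delta>; \<And>F. cellular_family T F \<Longrightarrow> |F| \<le>o \<delta>\<rbrakk> \<Longrightarrow> top_cellularity T \<le>o \<delta>"
proof -
  let ?K = "{\<delta> :: 'p set rel. Card_order \<delta> \<and> (\<forall>F. cellular_family T F \<longrightarrow> |F| \<le>o \<delta>)}"
  have "|UNIV :: 'p set set| \<in> ?K"
    by (simp add: card_of_Card_order card_of_mono1)
  then have ne: "?K \<noteq> {}" by blast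
  have co: "Card_order k" if "k \<in> ?K" for k
    using that by blast
  have mem: "top_cellularity T \<in> ?K"
    using least_card(1)[OF ne co] unfolding top_cellularity_def by blast
  show "Card_order (top_cellularity T)" using mem by blast
  show "|F| \<le>o top_cellularity T" if "cellular_family T F" using mem that by blast
  show "top_cellularity T \<le>o \<delta>"
    if \<delta>: "Card_order \<delta>" and bound: "\<And>F. cellular_family T F \<Longrightarrow> |F| \<le>o \<delta>"
  proof (rule ccontr)
    assume "\<not> top_cellularity T \<le>o \<delta>"
    moreover have "Well_order \<delta>" "Well_order (top_cellularity T)"
      using \<delta> mem by (auto intro: card_order_on_well_order_on)
    ultimately have less: "\<delta> <o top_cellularity T"
      by (simp add: not_ordLeq_iff_ordLess)
    then obtain \<epsilon> :: "'p set rel" where iso: "\<delta> =o \<epsilon>"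
      by (meson internalize_ordLess)
    have e: "\<epsilon> =o \<delta>" "Card_order \<epsilon>"
      using iso \<delta> ordIso_symmetric Card_order_ordIso2 by blast+
    have "\<epsilon> \<in> ?K"
      using e(2) bound ordLeq_ordIso_trans[OF _ iso] by blast
    then have "top_cellularity T \<le>o \<epsilon>"
      unfolding top_cellularity_def using least_card(2)[OF ne co] by blast
    then show False
      using not_ordLess_ordLeq[OF less] ordLeq_ordIso_trans[OF _ e(1)] by blast
  qed
qed

end

(*
  It suffices to find a base B of cones and a disjoint family F of cones with |B| \<le> |F|: each of
  the three cardinal functions is then trapped between |F| and |B|. This is shown for every open
  subset Y by induction on the size of a base B0 of Y. Call an open set small if it has a base of
  fewer than |B0| elements. If every point of Y has a small cone, then Y is partitioned into its
  maximal small cones and the induction hypothesis applies to each of them. Otherwise fix x all of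
  whose cones are not small and let D_j be the set of points that leave the cones of x exactly at
  level j. If D_j is small for all large j, then the families of the D_j together match a base of
  some cone of x. If instead cofinally many D_j are not small, there are at least cf(\<gamma>) of them,
  so the levels of a cofinal set K of size cf(\<gamma>) can be distributed injectively among them: every
  D_j that is not small contains an antichain at least as large as any given level of fewer than
  |B0| elements, and the union of the levels in K is a base. This last step replaces the
  Erdos-Tarski argument at singular cardinals and works at all cardinals.
*)
theory Submission
  imports Defs
begin

section \<open>Cardinal arithmetic\<close>

text \<open>If both factors are finite or one is empty, the product is finite; otherwise the larger
  factor is infinite and absorbs the product. This later bounds a union of few levels of bounded
  size, even below a singular cardinal.\<close>

lemma card_of_Times_ordLess_infinite:
  assumes C: "infinite C" and A: "|A| <o |C|" and B: "|B| <o |C|"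
  shows "|A \<times> B| <o |C|"
proof (cases "finite A \<and> finite B \<or> A = {} \<or> B = {}")
  case True
  then have "finite (A \<times> B)" by auto
  then show ?thesis
    using C finite_ordLess_infinite[OF card_of_Well_order card_of_Well_order, of "A \<times> B" C]
    by (simp add: Field_card_of)
next
  case False
  show ?thesis
  proof (cases "|A| \<le>o |B|")
    case True
    then have "infinite B" using False card_of_ordLeq_finite by blast
    then have "|A \<times> B| =o |B|" using card_of_Times_infinite[of B A] True False by blast
    then show ?thesis using B by (rule ordIso_ordLess_trans)
  next
    case BA: False
    then have BA: "|B| \<le>o |A|" using ordLeq_total[OF card_of_Well_order card_of_Well_order] by blast
    then have "infinite A" using False card_of_ordLeq_finite by blast
    then have "|A \<times> B| =o |A|" using card_of_Times_infinite[of A B] BA False by blast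
    then show ?thesis using A by (rule ordIso_ordLess_trans)
  qed
qed

section \<open>Nested partitions indexed by a well-order\<close>

text \<open>
  \<open>N i x\<close> is the set of members of \<open>X\<close> that agree with \<open>x\<close> below \<open>i\<close>; only the
  nestedness of these partitions matters for the combinatorial argument.
\<close>

locale nested_partitions =
  fixes r :: "'i rel" and X :: "'p set" and N :: "'i \<Rightarrow> 'p \<Rightarrow> 'p set"
  assumes wo: "Well_order r"
    and N_sub: "\<lbrakk>i \<in> Field r; x \<in> X\<rbrakk> \<Longrightarrow> N i x \<subseteq> X"
    and N_refl: "\<lbrakk>i \<in> Field r; x \<in> X\<rbrakk> \<Longrightarrow> x \<in> N i x"
    and N_eq: "\<lbrakk>i \<in> Field r; x \<in> X; y \<in> N i x\<rbrakk> \<Longrightarrow> N i y = N i x"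
    and N_mono: "\<lbrakk>(i, j) \<in> r; x \<in> X\<rbrakk> \<Longrightarrow> N j x \<subseteq> N i x"
begin

lemma r_total: "\<lbrakk>i \<in> Field r; j \<in> Field r\<rbrakk> \<Longrightarrow> (i, j) \<in> r \<or> (j, i) \<in> r"
  using wo wo_rel.TOTALS[of r] by (auto simp: wo_rel_def)

lemma r_refl: "i \<in> Field r \<Longrightarrow> (i, i) \<in> r"
  using r_total by blast

lemma r_antisym: "\<lbrakk>(i, j) \<in> r; (j, i) \<in> r\<rbrakk> \<Longrightarrow> i = j"
  using wo wo_rel.ANTISYM[of r] by (auto simp: wo_rel_def antisym_def)

lemma r_trans: "\<lbrakk>(i, j) \<in> r; (j, k) \<in> r\<rbrakk> \<Longrightarrow> (i, k) \<in> r"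
  using wo wo_rel.TRANS[of r] by (auto simp: wo_rel_def trans_def)

lemma r_Field: "(i, j) \<in> r \<Longrightarrow> i \<in> Field r \<and> j \<in> Field r"
  by (auto simp: Field_def)

lemma r_least:
  assumes "i \<in> Field r" "P i"
  obtains m where "m \<in> Field r" "P m" "\<And>k. \<lbrakk>k \<in> Field r; P k\<rbrakk> \<Longrightarrow> (m, k) \<in> r"
proof -
  let ?A = "{i \<in> Field r. P i}"
  have w: "wo_rel r" using wo by (simp add: wo_rel_def)
  have "?A \<subseteq> Field r" "?A \<noteq> {}" using assms by auto
  then have "wo_rel.isMinim r ?A (wo_rel.minim r ?A)"
    using wo_rel.minim_isMinim[OF w] by blast
  then show ?thesis
    using that unfolding wo_rel.isMinim_def[OF w] by blast
qed

lemma r_max: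
  assumes "i \<in> Field r" "j \<in> Field r"
  obtains k where "(i, k) \<in> r" "(j, k) \<in> r"
  using assms r_total r_refl by blast

lemma finite_bounded:
  assumes "finite C" "C \<subseteq> Field r" "m \<in> Field r"
  shows "\<exists>b\<in>Field r. \<forall>j\<in>C. (j, b) \<in> r"
  using assms(1,2)
proof (induction C)
  case empty
  then show ?case using assms(3) by blast
next
  case (insert j C)
  then obtain b where "b \<in> Field r" "\<forall>j\<in>C. (j, b) \<in> r" by auto
  moreover obtain k where "(b, k) \<in> r" "(j, k) \<in> r"
    using r_max \<open>b \<in> Field r\<close> insert.prems by blast
  ultimately show ?case using r_trans r_Field by blast
qed

section \<open>Open sets, cones, bases and antichains\<close>

text \<open>When \<open>N\<close> comes from sequences of length \<gamma> \<noteq> 0, these are the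
  open subsets of \<open>X\<close>.\<close>

definition cone_open :: "'p set \<Rightarrow> bool" where
  "cone_open Y \<longleftrightarrow> Y \<subseteq> X \<and> (\<forall>x\<in>Y. \<exists>i\<in>Field r. N i x \<subseteq> Y)"

definition cones :: "'p set \<Rightarrow> 'p set set" where
  "cones Y = {N i x | i x. i \<in> Field r \<and> x \<in> X \<and> N i x \<subseteq> Y}"

definition cone_base :: "'p set \<Rightarrow> 'p set set \<Rightarrow> bool" where
  "cone_base Y B \<longleftrightarrow> B \<subseteq> cones Y \<and> (\<forall>x\<in>Y. \<forall>i\<in>Field r. \<exists>V\<in>B. x \<in> V \<and> V \<subseteq> N i x)"

definition antichain_in :: "'p set \<Rightarrow> 'p set set \<Rightarrow> bool" where
  "antichain_in Y F \<longleftrightarrow> F \<subseteq> cones Y \<and> pairwise disjnt F"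

text \<open>No antichain of cones in \<open>Y\<close> exceeds a base in size, so this says that the
  least size of a base is attained by an antichain.\<close>

definition attained :: "'p set \<Rightarrow> bool" where
  "attained Y \<longleftrightarrow> (\<exists>B F. cone_base Y B \<and> antichain_in Y F \<and> |B| \<le>o |F| )"

lemma attainedI: "\<lbrakk>cone_base Y B; antichain_in Y F; |B| \<le>o |F|\<rbrakk> \<Longrightarrow> attained Y"
  unfolding attained_def by blast

lemma cones_mono: "Y \<subseteq> Z \<Longrightarrow> cones Y \<subseteq> cones Z"
  unfolding cones_def by blast

lemma cones_sub: "V \<in> cones Y \<Longrightarrow> V \<subseteq> Y"
  unfolding cones_def by blast

lemma cones_nonempty: "V \<in> cones Y \<Longrightarrow> V \<noteq> {}"
  unfolding cones_def using N_refl by blast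

lemma N_cones: "\<lbrakk>i \<in> Field r; x \<in> X; N i x \<subseteq> Y\<rbrakk> \<Longrightarrow> N i x \<in> cones Y"
  unfolding cones_def by blast

lemma N_disj:
  assumes "i \<in> Field r" "x \<in> X" "y \<in> X"
  shows "N i x = N i y \<or> disjnt (N i x) (N i y)"
  using assms N_eq unfolding disjnt_iff by metis

lemma cone_open_N: "\<lbrakk>i \<in> Field r; x \<in> X\<rbrakk> \<Longrightarrow> cone_open (N i x)"
  unfolding cone_open_def using N_sub N_eq by blast

lemma cone_open_subN:
  assumes "cone_open Y" "x \<in> Y" "i \<in> Field r"
  obtains k where "(i, k) \<in> r" "N k x \<subseteq> Y"
proof -
  obtain j where j: "j \<in> Field r" "N j x \<subseteq> Y" using assms unfolding cone_open_def by blast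
  obtain k where "(i, k) \<in> r" "(j, k) \<in> r" using r_max assms j by blast
  then show ?thesis using that[of k] j N_mono[of j k x] assms unfolding cone_open_def by blast
qed

text \<open>Cones are nonempty, so each \<open>V\<close> lies in only one of the disjoint sets
  \<open>D p\<close> and thereby determines \<open>p\<close>. Hence the projection from the disjoint
  sum to the union is injective, and gluing loses no cardinality.\<close>

lemma antichain_UN:
  assumes "\<And>p. p \<in> P \<Longrightarrow> antichain_in (D p) (F p)"
    and "\<And>p q. \<lbrakk>p \<in> P; q \<in> P; p \<noteq> q\<rbrakk> \<Longrightarrow> disjnt (D p) (D q)"
    and "\<And>p. p \<in> P \<Longrightarrow> D p \<subseteq> Y"
  shows "antichain_in Y (\<Union>p\<in>P. F p)" and "|SIGMA p:P. F p| \<le>o |\<Union>p\<in>P. F p|"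
proof -
  have sub: "V \<subseteq> D p" "V \<noteq> {}" "V \<in> cones Y" if "p \<in> P" "V \<in> F p" for p V
  proof -
    have V: "V \<in> cones (D p)" using assms(1)[OF that(1)] that(2) unfolding antichain_in_def by blast
    then show "V \<subseteq> D p" by (rule cones_sub)
    show "V \<noteq> {}" using V by (rule cones_nonempty)
    show "V \<in> cones Y" using V cones_mono[OF assms(3)[OF that(1)]] by blast
  qed
  show "antichain_in Y (\<Union>p\<in>P. F p)"
    unfolding antichain_in_def pairwise_def
  proof (intro conjI ballI impI)
    show "(\<Union>p\<in>P. F p) \<subseteq> cones Y" using sub by blast
    fix V W assume "V \<in> (\<Union>p\<in>P. F p)" "W \<in> (\<Union>p\<in>P. F p)" and ne: "V \<noteq> W"
    then obtain p q where pq: "p \<in> P" "V \<in> F p" "q \<in> P" "W \<in> F q" by blast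
    show "disjnt V W"
    proof (cases "p = q")
      case True
      then show ?thesis using assms(1) pq ne unfolding antichain_in_def pairwise_def by blast
    next
      case False
      then show ?thesis
        using assms(2)[of p q] sub(1)[of p V] sub(1)[of q W] pq unfolding disjnt_iff by blast
    qed
  qed
  have "inj_on snd (SIGMA p:P. F p)"
  proof (rule inj_onI)
    fix a b assume "a \<in> (SIGMA p:P. F p)" "b \<in> (SIGMA p:P. F p)" "snd a = snd b"
    then obtain p q V where *: "a = (p, V)" "b = (q, V)" "p \<in> P" "q \<in> P" "V \<in> F p" "V \<in> F q"
      by (metis SigmaE snd_conv)
    have "V \<subseteq> D p" "V \<subseteq> D q" "V \<noteq> {}" using sub * by blast+
    then have "p = q" using assms(2)[OF *(3,4)] unfolding disjnt_iff by blast
    then show "a = b" using * by simp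
  qed
  moreover have "snd ` (SIGMA p:P. F p) \<subseteq> (\<Union>p\<in>P. F p)" by auto
  ultimately show "|SIGMA p:P. F p| \<le>o |\<Union>p\<in>P. F p|"
    using card_of_ordLeq by blast
qed

lemma UN_card_le:
  assumes "\<And>p. p \<in> P \<Longrightarrow> |B p| \<le>o |F p|"
  shows "|\<Union>p\<in>P. B p| \<le>o |SIGMA p:P. F p|"
  by (rule ordLeq_transitive[OF card_of_UNION_Sigma card_of_Sigma_mono1]) (use assms in blast)

text \<open>Bases and antichains are both glued along the partition; their sizes are compared
  through the disjoint sum of the families \<open>F p\<close>.\<close>

lemma attained_UN:
  assumes "\<And>p. p \<in> P \<Longrightarrow> attained p" and "pairwise disjnt P" and "\<Union>P = Y"
  shows "attained Y"
proof -
  obtain B F where BF: "\<And>p. p \<in> P \<Longrightarrow> cone_base p (B p) \<and> antichain_in p (F p) \<and> |B p| \<le>o |F p|"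
    using assms(1) unfolding attained_def by metis
  have sub: "p \<subseteq> Y" if "p \<in> P" for p using that assms(3) by blast
  have "antichain_in Y (\<Union>p\<in>P. F p)" "|SIGMA p:P. F p| \<le>o |\<Union>p\<in>P. F p|"
  proof -
    have "disjnt p q" if "p \<in> P" "q \<in> P" "p \<noteq> q" for p q
      using assms(2) that unfolding pairwise_def by blast
    then show "antichain_in Y (\<Union>p\<in>P. F p)" "|SIGMA p:P. F p| \<le>o |\<Union>p\<in>P. F p|"
      using antichain_UN[of P "\<lambda>p. p" F Y] BF sub by simp_all
  qed
  moreover have "cone_base Y (\<Union>p\<in>P. B p)"
    unfolding cone_base_def
  proof (intro conjI ballI)
    show "(\<Union>p\<in>P. B p) \<subseteq> cones Y"
    proof
      fix V assume "V \<in> (\<Union>p\<in>P. B p)"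
      then obtain p where p: "p \<in> P" "V \<in> B p" by blast
      then have "V \<in> cones p" using BF[OF p(1)] unfolding cone_base_def by blast
      then show "V \<in> cones Y" using cones_mono[OF sub[OF p(1)]] by blast
    qed
    fix x i assume x: "x \<in> Y" and i: "i \<in> Field r"
    then obtain p where p: "p \<in> P" "x \<in> p" using assms(3) by blast
    then have "\<exists>V\<in>B p. x \<in> V \<and> V \<subseteq> N i x" using BF[OF p(1)] i unfolding cone_base_def by blast
    then show "\<exists>V\<in>\<Union>p\<in>P. B p. x \<in> V \<and> V \<subseteq> N i x" using p(1) by blast
  qed
  moreover have "|\<Union>p\<in>P. B p| \<le>o |SIGMA p:P. F p|"
    by (rule UN_card_le) (use BF in blast)
  ultimately show ?thesis
    by (metis attainedI ordLeq_transitive)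
qed

section \<open>Levels and cofinal sets of indices\<close>

text \<open>Points of \<open>Y\<close> whose cone at level \<open>k\<close> sticks out of
  \<open>Y\<close> may stay uncovered; if \<open>Y\<close> is open, later levels reach them.\<close>

definition level :: "'i \<Rightarrow> 'p set \<Rightarrow> 'p set set" where
  "level k Y = {N k y | y. y \<in> Y \<and> N k y \<subseteq> Y}"

lemma antichain_level:
  assumes "k \<in> Field r" "Y \<subseteq> X"
  shows "antichain_in Y (level k Y)"
  unfolding antichain_in_def pairwise_def
proof (intro conjI ballI impI)
  show "level k Y \<subseteq> cones Y" using assms unfolding level_def cones_def by blast
  fix V W assume "V \<in> level k Y" "W \<in> level k Y" "V \<noteq> W"
  then obtain x y where "x \<in> X" "y \<in> X" "V = N k x" "W = N k y" "N k x \<noteq> N k y"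
    using assms(2) unfolding level_def by blast
  then show "disjnt V W" using N_disj[OF assms(1)] by blast
qed

definition cofin :: "'i set \<Rightarrow> bool" where
  "cofin K \<longleftrightarrow> K \<subseteq> Field r \<and> (\<forall>m\<in>Field r. \<exists>k\<in>K. (m, k) \<in> r)"

lemma cone_base_levels:
  assumes "cone_open Y" "cofin K"
  shows "cone_base Y (\<Union>k\<in>K. level k Y)"
  unfolding cone_base_def
proof (intro conjI ballI)
  have Y: "Y \<subseteq> X" using assms(1) cone_open_def by blast
  show "(\<Union>k\<in>K. level k Y) \<subseteq> cones Y"
    using assms(2) Y unfolding cofin_def level_def cones_def by blast
  fix x i assume x: "x \<in> Y" and i: "i \<in> Field r"
  obtain j where j: "(i, j) \<in> r" "N j x \<subseteq> Y" by (rule cone_open_subN[OF assms(1) x i])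
  then obtain k where k: "k \<in> K" "(j, k) \<in> r"
    using assms(2) r_Field unfolding cofin_def by blast
  have "x \<in> X" "k \<in> Field r" using x Y k(2) r_Field by blast+
  then have *: "N k x \<subseteq> N j x" "N j x \<subseteq> N i x" "x \<in> N k x"
    by (simp_all add: N_mono[OF k(2)] N_mono[OF j(1)] N_refl)
  then have "N k x \<in> level k Y" using j(2) x unfolding level_def by blast
  then show "\<exists>V\<in>\<Union>k\<in>K. level k Y. x \<in> V \<and> V \<subseteq> N i x"
    using * k(1) by (intro bexI[of _ "N k x"]) auto
qed

text \<open>Cardinals are well-ordered, so a cofinal set of least size exists; its size is the
  cofinality of \<gamma>.\<close>

lemma min_cofin:
  obtains K where "cofin K" "\<And>K'. cofin K' \<Longrightarrow> |K| \<le>o |K'|"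
proof -
  have "cofin (Field r)" unfolding cofin_def using r_refl by blast
  then have "{|K| | K. cofin K} \<noteq> {}" by blast
  moreover have "\<forall>k \<in> {|K| | K. cofin K}. Card_order k"
    using card_of_Card_order by blast
  ultimately have "\<exists>k \<in> {|K| | K. cofin K}. \<forall>k'\<in>{|K| | K. cofin K}. k \<le>o k'"
    by (rule exists_minim_Card_order)
  then obtain K where "cofin K" "\<forall>k'\<in>{|K| | K. cofin K}. |K| \<le>o k'" by blast
  then show ?thesis using that[of K] by blast
qed

section \<open>Points leaving the cones of a fixed point\<close>

text \<open>These are the sets D_j: the points that follow \<open>x\<close> through every cone
  before level \<open>j\<close> and depart there.\<close>

definition leaving :: "'p \<Rightarrow> 'i \<Rightarrow> 'p set" where
  "leaving x j = {y \<in> X. y \<notin> N j x \<and> (\<forall>k. (k, j) \<in> r \<and> k \<noteq> j \<longrightarrow> y \<in> N k x)}"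

text \<open>Being in the same cone at level \<open>j\<close> forces the same cone at all earlier
  levels, so the whole cone of \<open>y\<close> departs from \<open>x\<close> at the same
  moment.\<close>

lemma leaving_N:
  assumes "x \<in> X" "j \<in> Field r" "y \<in> leaving x j"
  shows "N j y \<subseteq> leaving x j"
proof
  fix z assume z: "z \<in> N j y"
  have y: "y \<in> X" using assms leaving_def by blast
  have zX: "z \<in> X" using z N_sub[OF assms(2) y] by blast
  have zy: "N j z = N j y" by (rule N_eq[OF assms(2) y z])
  have "z \<notin> N j x"
    using zy N_eq[OF assms(2,1)] N_refl[OF assms(2) y] assms(3) unfolding leaving_def by blast
  moreover have "z \<in> N k x" if "(k, j) \<in> r" "k \<noteq> j" for k
  proof -
    have "y \<in> N k x" using assms(3) that unfolding leaving_def by blast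
    then have "N k y = N k x" using N_eq[of k x y] r_Field[OF that(1)] assms(1) by simp
    then show ?thesis using N_mono[OF that(1) y] z by blast
  qed
  ultimately show "z \<in> leaving x j" using zX unfolding leaving_def by blast
qed

lemma cone_open_leaving: "\<lbrakk>x \<in> X; j \<in> Field r\<rbrakk> \<Longrightarrow> cone_open (leaving x j)"
  unfolding cone_open_def using leaving_N leaving_def by blast

lemma leaving_disj:
  assumes "i \<in> Field r" "j \<in> Field r" "i \<noteq> j"
  shows "disjnt (leaving x i) (leaving x j)"
  using r_total[OF assms(1,2)] assms(3) unfolding leaving_def disjnt_iff by blast

lemma leaving_sub: "\<lbrakk>(m, j) \<in> r; m \<noteq> j\<rbrakk> \<Longrightarrow> leaving x j \<subseteq> N m x"
  unfolding leaving_def by blast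

text \<open>The least level whose cone of \<open>x\<close> misses \<open>y\<close> is the departure
  level; it lies beyond \<open>m\<close> because \<open>y\<close> is still in
  \<open>N m x\<close>.\<close>

lemma leaving_cases:
  assumes "x \<in> X" "y \<in> N m x" "m \<in> Field r" "i \<in> Field r" "y \<notin> N i x"
  obtains j where "(m, j) \<in> r" "j \<noteq> m" "(j, i) \<in> r" "y \<in> leaving x j"
proof -
  obtain j where j: "j \<in> Field r" "y \<notin> N j x"
    "\<And>k. \<lbrakk>k \<in> Field r; y \<notin> N k x\<rbrakk> \<Longrightarrow> (j, k) \<in> r"
    using r_least[of i "\<lambda>j. y \<notin> N j x"] assms by blast
  have "y \<in> leaving x j"
    using j r_antisym r_Field N_sub[OF assms(3,1)] assms(2) unfolding leaving_def by blast
  moreover have "(j, m) \<notin> r"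
    using N_mono[of j m x] assms j by blast
  ultimately show ?thesis
    using that[of j] j r_total[of j m] assms by blast
qed

section \<open>The induction step\<close>

lemma attained_step:
  assumes Y: "cone_open Y" and B0: "cone_base Y B0"
    and IH: "\<And>Z B. \<lbrakk>cone_open Z; cone_base Z B; |B| <o |B0|\<rbrakk> \<Longrightarrow> attained Z"
  shows "attained Y"
proof -
  define small where "small Z \<longleftrightarrow> (\<exists>B. cone_base Z B \<and> |B| <o |B0| )" for Z
  have small_attained: "attained Z" if "cone_open Z" "small Z" for Z
    using IH that unfolding small_def by blast
  \<comment> \<open>A set that is not small turns any of its bases into an upper bound for
    \<open>|B0|\<close>. So an antichain of \<open>Y\<close> only has to match a base of a single
    cone of \<open>x\<close>.\<close>
  have not_small: "|B0| \<le>o |B|" if "\<not> small Z" "cone_base Z B" for Z B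
  proof -
    have "\<not> |B| <o |B0|" using that unfolding small_def by blast
    then show ?thesis
      using not_ordLess_iff_ordLeq[OF card_of_Well_order card_of_Well_order] by blast
  qed
  have attainedY: "attained Y" if "antichain_in Y F" "|B0| \<le>o |F|" for F
    using attainedI[OF B0] that by blast
  have YX: "Y \<subseteq> X" using Y cone_open_def by blast
  show ?thesis
  proof (cases "\<forall>x\<in>Y. \<exists>i\<in>Field r. N i x \<subseteq> Y \<and> small (N i x)")
    case True
    define Q where "Q x i \<longleftrightarrow> i \<in> Field r \<and> N i x \<subseteq> Y \<and> small (N i x)" for x i
    \<comment> \<open>The least admissible index gives the largest small cone around
      \<open>x\<close>.\<close>
    define P where "P = {N i x | i x. x \<in> Y \<and> Q x i \<and> (\<forall>k. Q x k \<longrightarrow> (i, k) \<in> r)}"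
    \<comment> \<open>If the cones meet and \<open>i\<close> comes first, then \<open>y\<close> lies
      in \<open>N i x\<close>, so \<open>i\<close> is admissible for \<open>y\<close> too, and
      minimality of \<open>j\<close> forces \<open>i = j\<close>.\<close>
    have eq: "N i x = N j y"
      if "x \<in> Y" "Q x i" "\<forall>k. Q x k \<longrightarrow> (i, k) \<in> r" "y \<in> Y" "Q y j" "\<forall>k. Q y k \<longrightarrow> (j, k) \<in> r"
        "(i, j) \<in> r" "z \<in> N i x" "z \<in> N j y" for x i y j z
    proof -
      have F: "i \<in> Field r" "j \<in> Field r" "x \<in> X" "y \<in> X" using that YX r_Field by blast+
      then have "z \<in> N i y" using N_mono[OF that(7)] that(9) by blast
      then have *: "N i y = N i x" using N_eq F that(8) by blast
      then have "Q y i" using that(2) unfolding Q_def by simp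
      then have "i = j" using that r_antisym by blast
      then show ?thesis using * by simp
    qed
    have "pairwise disjnt P"
      unfolding pairwise_def
    proof (intro ballI impI, rule ccontr)
      fix V W assume "V \<in> P" "W \<in> P" "V \<noteq> W" "\<not> disjnt V W"
      then obtain i x j y z where
        "x \<in> Y" "Q x i" "\<forall>k. Q x k \<longrightarrow> (i, k) \<in> r" "y \<in> Y" "Q y j" "\<forall>k. Q y k \<longrightarrow> (j, k) \<in> r"
        "z \<in> N i x" "z \<in> N j y" "N i x \<noteq> N j y"
        unfolding P_def disjnt_iff by blast
      moreover have "(i, j) \<in> r \<or> (j, i) \<in> r" using calculation r_total unfolding Q_def by blast
      ultimately show False using eq by metis
    qed
    moreover have "\<Union>P = Y"
    proof
      show "\<Union>P \<subseteq> Y" unfolding P_def Q_def by blast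
      show "Y \<subseteq> \<Union>P"
      proof
        fix x assume x: "x \<in> Y"
        then obtain i0 where "i0 \<in> Field r" "Q x i0" using True unfolding Q_def by blast
        then obtain i where "i \<in> Field r" "Q x i" "\<And>k. \<lbrakk>k \<in> Field r; Q x k\<rbrakk> \<Longrightarrow> (i, k) \<in> r"
          using r_least by blast
        then have "N i x \<in> P" "x \<in> N i x"
          using x YX N_refl unfolding P_def Q_def by blast+
        then show "x \<in> \<Union>P" by blast
      qed
    qed
    moreover have "attained p" if p: "p \<in> P" for p
    proof -
      obtain i x where "p = N i x" "Q x i" "x \<in> Y" using p unfolding P_def by blast
      then show ?thesis using small_attained cone_open_N YX unfolding Q_def by blast
    qed
    ultimately show ?thesis using attained_UN by blast
  next
    case False
    then obtain x where x: "x \<in> Y" and big: "\<And>i. \<lbrakk>i \<in> Field r; N i x \<subseteq> Y\<rbrakk> \<Longrightarrow> \<not> small (N i x)"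
      by blast
    have xX: "x \<in> X" using x YX by blast
    obtain i0 where i0: "i0 \<in> Field r" "N i0 x \<subseteq> Y" using Y x unfolding cone_open_def by blast
    let ?D = "leaving x"
    define S where "S = {j. (i0, j) \<in> r \<and> i0 \<noteq> j \<and> \<not> small (?D j) \<and> ?D j \<noteq> {}}"
    have S_Field: "S \<subseteq> Field r" unfolding S_def using r_Field by blast
    have unbdd_infinite: "infinite C" if "C \<subseteq> Field r" "\<not> (\<exists>m\<in>Field r. \<forall>j\<in>C. (j, m) \<in> r)" for C
      using finite_bounded[of C i0] that i0 by blast
    \<comment> \<open>One cone chosen from each of the disjoint nonempty sets \<open>?D j\<close>
      yields an antichain as large as the index set.\<close>
    have select: "\<exists>F. antichain_in Y F \<and> |C| \<le>o |F|"
      if C: "\<And>j. j \<in> C \<Longrightarrow> (i0, j) \<in> r \<and> i0 \<noteq> j \<and> ?D j \<noteq> {}" for C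
    proof -
      have "\<exists>V. antichain_in (?D j) {V}" if j: "j \<in> C" for j
      proof -
        obtain y where y: "y \<in> ?D j" using C j by blast
        then have yX: "y \<in> X" unfolding leaving_def by blast
        have "j \<in> Field r" using C[OF j] r_Field by blast
        then have "N j y \<in> cones (?D j)" by (intro N_cones leaving_N xX yX y)
        then show ?thesis unfolding antichain_in_def by auto
      qed
      then obtain V where V: "\<And>j. j \<in> C \<Longrightarrow> antichain_in (?D j) {V j}" by metis
      have F: "antichain_in Y (\<Union>j\<in>C. {V j})" "|SIGMA j:C. {V j}| \<le>o |\<Union>j\<in>C. {V j}|"
      proof -
        have CF: "j \<in> Field r" if "j \<in> C" for j using C[OF that] r_Field by blast
        have "?D j \<subseteq> Y" if "j \<in> C" for j using C[OF that] leaving_sub[of i0 j x] i0(2) by blast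
        then show "antichain_in Y (\<Union>j\<in>C. {V j})" "|SIGMA j:C. {V j}| \<le>o |\<Union>j\<in>C. {V j}|"
          using antichain_UN[of C ?D "\<lambda>j. {V j}" Y] V leaving_disj CF by simp_all
      qed
      have "|C| \<le>o |SIGMA j:C. {V j}|"
        by (rule card_of_ordLeqI[of "\<lambda>j. (j, V j)"]) (auto simp: inj_on_def)
      then show ?thesis using F(1) ordLeq_transitive[OF _ F(2)] by blast
    qed
    show ?thesis
    proof (cases "\<exists>m\<in>Field r. \<forall>j\<in>S. (j, m) \<in> r")
      case True
      then obtain m0 where m0: "m0 \<in> Field r" "\<forall>j\<in>S. (j, m0) \<in> r" by blast
      obtain m where m: "(m0, m) \<in> r" "(i0, m) \<in> r" using r_max m0 i0 by blast
      \<comment> \<open>Since \<open>m\<close> lies beyond all of \<open>S\<close>, every nonempty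
        \<open>?D j\<close> with \<open>j\<close> past \<open>m\<close> is small and falls under the
        induction hypothesis.\<close>
      define C where "C = {j. (m, j) \<in> r \<and> j \<noteq> m \<and> ?D j \<noteq> {}}"
      have mF: "m \<in> Field r" using m r_Field by blast
      have NmY: "N m x \<subseteq> Y" using N_mono[OF m(2) xX] i0 by blast
      have CF: "C \<subseteq> Field r" unfolding C_def using r_Field by blast
      have Ci0: "(i0, j) \<in> r \<and> i0 \<noteq> j" if "j \<in> C" for j
        using that m r_trans r_antisym unfolding C_def by blast
      have C_small: "small (?D j)" if "j \<in> C" for j
      proof (rule ccontr)
        assume "\<not> small (?D j)"
        then have "j \<in> S" using Ci0[OF that] that unfolding S_def C_def by blast
        then have "(j, m) \<in> r" using m0 m r_trans by blast
        then show False using that r_antisym unfolding C_def by blast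
      qed
      show ?thesis
      proof (cases "\<exists>b\<in>Field r. \<forall>j\<in>C. (j, b) \<in> r")
        case True
        then obtain b0 where b0: "b0 \<in> Field r" "\<forall>j\<in>C. (j, b0) \<in> r" by blast
        obtain b where b: "(b0, b) \<in> r" "(m, b) \<in> r" using r_max b0 mF by blast
        have bF: "b \<in> Field r" using b r_Field by blast
        have NbY: "N b x \<subseteq> Y" by (rule subset_trans[OF N_mono[OF b(2) xX] NmY])
        \<comment> \<open>A point of \<open>N b x\<close> leaving later would do so at a level of
          \<open>C\<close> beyond \<open>b\<close>, but \<open>b\<close> bounds \<open>C\<close>. So
          the cones of \<open>x\<close> stop shrinking at \<open>b\<close>, and the single set
          \<open>N b x\<close> is a base of itself; thus \<open>|B0|\<close> is at most 1.\<close>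
        have stable: "N b x \<subseteq> N i x" if i: "i \<in> Field r" for i
        proof (rule ccontr)
          assume "\<not> N b x \<subseteq> N i x"
          then obtain y where "y \<in> N b x" "y \<notin> N i x" by blast
          then obtain j where j: "(b, j) \<in> r" "j \<noteq> b" "y \<in> ?D j"
            using leaving_cases[OF xX _ bF i] by metis
          then have "j \<in> C" using b r_trans r_antisym unfolding C_def by blast
          then show False using b0 b j r_trans r_antisym by blast
        qed
        have "cone_base (N b x) {N b x}"
          unfolding cone_base_def
        proof (intro conjI ballI)
          show "{N b x} \<subseteq> cones (N b x)" using N_cones bF xX by blast
          fix y i assume y: "y \<in> N b x" and i: "i \<in> Field r"
          then have "N i y = N i x" using N_eq[OF i xX] stable[OF i] by blast
          then show "\<exists>V\<in>{N b x}. y \<in> V \<and> V \<subseteq> N i y" using y stable[OF i] by blast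
        qed
        then have "|B0| \<le>o |{N b x}|" using not_small big[OF bF NbY] by blast
        moreover have "antichain_in Y {N b x}"
          unfolding antichain_in_def using N_cones[OF bF xX NbY] by auto
        ultimately show ?thesis using attainedY by blast
      next
        case unbdd: False
        then have Cinf: "infinite C" using unbdd_infinite CF by blast
        have "attained (?D j)" if "j \<in> C" for j
          using small_attained[OF cone_open_leaving C_small] xX CF that by blast
        then obtain B F where BF:
          "\<And>j. j \<in> C \<Longrightarrow> cone_base (?D j) (B j) \<and> antichain_in (?D j) (F j) \<and> |B j| \<le>o |F j|"
          unfolding attained_def by metis
        have DY: "?D j \<subseteq> N m x" if "j \<in> C" for j
          using leaving_sub that unfolding C_def by blast
        have F: "antichain_in Y (\<Union>j\<in>C. F j)" "|SIGMA j:C. F j| \<le>o |\<Union>j\<in>C. F j|"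
        proof -
          have "?D j \<subseteq> Y" "j \<in> Field r" if "j \<in> C" for j using DY[OF that] NmY CF that by blast+
          then show "antichain_in Y (\<Union>j\<in>C. F j)" "|SIGMA j:C. F j| \<le>o |\<Union>j\<in>C. F j|"
            using antichain_UN[of C ?D F Y] BF leaving_disj by simp_all
        qed
        \<comment> \<open>The families \<open>B j\<close> serve the points that leave
          \<open>x\<close> at some level past \<open>m\<close>. All other points of
          \<open>N m x\<close> share every cone with \<open>x\<close>, and the cones of
          \<open>x\<close> at the unbounded levels \<open>C\<close> serve them.\<close>
        have "cone_base (N m x) ((\<lambda>j. N j x) ` C \<union> (\<Union>j\<in>C. B j))"
          unfolding cone_base_def
        proof (intro conjI ballI)
          have "N j x \<in> cones (N m x)" if "j \<in> C" for j
            by (intro N_cones N_mono xX) (use CF that C_def in blast)+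
          moreover have "B j \<subseteq> cones (N m x)" if "j \<in> C" for j
            using BF[OF that] cones_mono[OF DY[OF that]] unfolding cone_base_def by blast
          ultimately show "(\<lambda>j. N j x) ` C \<union> (\<Union>j\<in>C. B j) \<subseteq> cones (N m x)" by blast
          fix y i assume y: "y \<in> N m x" and i: "i \<in> Field r"
          show "\<exists>V\<in>(\<lambda>j. N j x) ` C \<union> (\<Union>j\<in>C. B j). y \<in> V \<and> V \<subseteq> N i y"
          proof (cases "\<exists>j\<in>C. y \<in> ?D j")
            case True
            then obtain j where j: "j \<in> C" "y \<in> ?D j" by blast
            then have "\<exists>V\<in>B j. y \<in> V \<and> V \<subseteq> N i y"
              using BF[OF j(1)] i unfolding cone_base_def by blast
            then show ?thesis using j(1) by blast
          next
            case False
            have all: "y \<in> N k x" if k: "k \<in> Field r" for k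
            proof (rule ccontr)
              assume "y \<notin> N k x"
              then obtain j where "(m, j) \<in> r" "j \<noteq> m" "y \<in> ?D j"
                using leaving_cases[OF xX y mF k] by metis
              then show False using False unfolding C_def by blast
            qed
            obtain j where j: "j \<in> C" "(j, i) \<notin> r" using unbdd i by blast
            then have jF: "j \<in> Field r" using CF by blast
            then have "(i, j) \<in> r" using r_total[OF i] j(2) by blast
            then have "N j x \<subseteq> N i x" using N_mono xX by blast
            then have "y \<in> N j x \<and> N j x \<subseteq> N i y"
              using all[OF jF] N_eq[OF i xX all[OF i]] by simp
            then show ?thesis using j(1) by blast
          qed
        qed
        then have le: "|B0| \<le>o |(\<lambda>j. N j x) ` C \<union> (\<Union>j\<in>C. B j)|"
          using not_small big[OF mF NmY] by blast
        \<comment> \<open>One member from each \<open>F j\<close> shows that the glued antichain has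
          size at least \<open>|C|\<close>. As \<open>C\<close> is infinite, the antichain then
          absorbs the additional cones of \<open>x\<close> in the base.\<close>
        have Fne: "F j \<noteq> {}" if "j \<in> C" for j
        proof
          assume "F j = {}"
          then have "|B j| \<le>o |{} :: 'p set set|" using BF[OF that] by simp
          then have "B j = {}" by (simp add: card_of_empty3)
          moreover have "\<exists>y. y \<in> ?D j" using that unfolding C_def by blast
          ultimately show False using BF[OF that] mF unfolding cone_base_def by blast
        qed
        let ?F = "\<Union>j\<in>C. F j"
        define V where "V j = (SOME V. V \<in> F j)" for j
        have "V j \<in> F j" if "j \<in> C" for j
          using Fne[OF that] unfolding V_def by (simp add: some_in_eq)
        then have "|C| \<le>o |SIGMA j:C. F j|"
          by (intro card_of_ordLeqI[of "\<lambda>j. (j, V j)"]) (auto simp: inj_on_def)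
        then have CleF: "|C| \<le>o |?F|" by (rule ordLeq_transitive[OF _ F(2)])
        then have inf: "infinite ?F" using Cinf card_of_ordLeq_infinite by blast
        have "|(\<lambda>j. N j x) ` C| \<le>o |?F|"
          by (rule ordLeq_transitive[OF card_of_image CleF])
        moreover have "|\<Union>j\<in>C. B j| \<le>o |?F|"
          by (rule ordLeq_transitive[OF UN_card_le F(2)]) (use BF in blast)
        ultimately have "|(\<lambda>j. N j x) ` C \<union> (\<Union>j\<in>C. B j)| \<le>o |?F|"
          using card_of_Un_ordLeq_infinite_Field[of "|?F|"] inf card_of_Card_order[of ?F]
          by (simp add: Field_card_of)
        then show ?thesis by (rule attainedY[OF F(1) ordLeq_transitive[OF le]])
      qed
    next
      case unbdd: False
      have Sinf: "infinite S" using unbdd_infinite S_Field unbdd by blast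
      have cofS: "cofin S" unfolding cofin_def using S_Field unbdd r_total by blast
      \<comment> \<open>As \<open>S\<close> is cofinal, it has at least cf(\<gamma>) elements, so
        \<open>g\<close> can assign to each level in \<open>K\<close> its own set
        \<open>?D (g k)\<close>.\<close>
      obtain K where K: "cofin K" "\<And>K'. cofin K' \<Longrightarrow> |K| \<le>o |K'|" using min_cofin by blast
      have KS: "|K| \<le>o |S|" using K cofS by blast
      then obtain g where g: "inj_on g K" "g ` K \<subseteq> S"
        unfolding card_of_ordLeq[symmetric] by blast
      have KF: "K \<subseteq> Field r" using K cofin_def by blast
      have S_D: "(i0, j) \<in> r \<and> i0 \<noteq> j \<and> ?D j \<noteq> {}" if "j \<in> S" for j
        using that unfolding S_def by blast
      have DY: "?D j \<subseteq> Y" if "j \<in> S" for j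
        using S_D[OF that] leaving_sub i0 by blast
      \<comment> \<open>The levels of this cone in \<open>K\<close> form a base of it, so their
        union has at least \<open>|B0|\<close> members; these are the levels to be matched.\<close>
      let ?Z = "N i0 x"
      have Zopn: "cone_open ?Z" using cone_open_N i0 xX by blast
      have lev: "antichain_in Y (level k ?Z)" if "k \<in> K" for k
      proof -
        have "antichain_in ?Z (level k ?Z)"
          using antichain_level that KF N_sub[OF i0(1) xX] by blast
        then show ?thesis using cones_mono[OF i0(2)] unfolding antichain_in_def by blast
      qed
      have "|S| <o |B0| \<or> |B0| \<le>o |S|"
        "|level k ?Z| <o |B0| \<or> |B0| \<le>o |level k ?Z|" for k
        by (rule ordLess_or_ordLeq[OF card_of_Well_order card_of_Well_order])+
      \<comment> \<open>One cone per element of \<open>S\<close>, or one single level, may already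
        be a large enough antichain. The remaining case has \<open>|S|\<close>, hence
        \<open>|K|\<close>, and all levels strictly below \<open>|B0|\<close>.\<close>
      then consider "|B0| \<le>o |S|" | k where "k \<in> K" "|B0| \<le>o |level k ?Z|"
        | "|S| <o |B0|" "\<And>k. k \<in> K \<Longrightarrow> |level k ?Z| <o |B0|"
        by blast
      then show ?thesis
      proof cases
        case 1
        then show ?thesis using select[of S] S_D attainedY ordLeq_transitive[OF 1] by blast
      next
        case 2
        then show ?thesis using lev attainedY by blast
      next
        case 3
        have B0inf: "infinite B0"
          using card_of_ordLeq_infinite[OF ordLess_imp_ordLeq[OF 3(1)] Sinf] .
        have KB0: "|K| <o |B0|" by (rule ordLeq_ordLess_trans[OF KS 3(1)])
        have "\<exists>l\<in>K. |level k ?Z| \<le>o |level l (?D j)|" if k: "k \<in> K" and j: "j \<in> S" for k j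
        \<comment> \<open>otherwise the levels in \<open>K\<close> would form a base of \<open>?D j\<close> of size below \<open>|B0|\<close>\<close>
        proof (rule ccontr)
          assume "\<not> (\<exists>l\<in>K. |level k ?Z| \<le>o |level l (?D j)| )"
          then have "|level l (?D j)| \<le>o |level k ?Z|" if "l \<in> K" for l
            using that ordLeq_total[OF card_of_Well_order card_of_Well_order] by blast
          then have "|\<Union>l\<in>K. level l (?D j)| \<le>o |K \<times> level k ?Z|"
            using UN_card_le[of K "\<lambda>l. level l (?D j)" "\<lambda>_. level k ?Z"] by blast
          moreover have "|K \<times> level k ?Z| <o |B0|"
            using card_of_Times_ordLess_infinite[OF B0inf KB0 3(2)[OF k]] by blast
          moreover have "|B0| \<le>o |\<Union>l\<in>K. level l (?D j)|"
            using not_small[OF _ cone_base_levels[OF cone_open_leaving[OF xX] K(1)]] j S_Field unfolding S_def by blast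
          ultimately show False
            by (metis ordLeq_ordLess_trans not_ordLess_ordLeq)
        qed
        then have "\<forall>k\<in>K. \<exists>l\<in>K. |level k ?Z| \<le>o |level l (?D (g k))|" using g by blast
        \<comment> \<open>\<open>h k\<close> is the level used inside \<open>?D (g k)\<close>.
          Different \<open>k\<close> may share the same \<open>h k\<close>; disjointness comes from
          the injectivity of \<open>g\<close>.\<close>
        then obtain h where h: "\<And>k. k \<in> K \<Longrightarrow> h k \<in> K"
          "\<And>k. k \<in> K \<Longrightarrow> |level k ?Z| \<le>o |level (h k) (?D (g k))|"
          by metis
        have gS: "g k \<in> S" "g k \<in> Field r" if "k \<in> K" for k using that g S_Field by blast+
        have a: "antichain_in (?D (g k)) (level (h k) (?D (g k)))" if "k \<in> K" for k
        proof (rule antichain_level)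
          show "h k \<in> Field r" using h(1)[OF that] KF by blast
          show "?D (g k) \<subseteq> X" unfolding leaving_def by blast
        qed
        have d: "disjnt (?D (g k)) (?D (g l))" if "k \<in> K" "l \<in> K" "k \<noteq> l" for k l
        proof -
          have "g k \<noteq> g l" using that g(1) by (meson inj_onD)
          then show ?thesis using leaving_disj gS(2) that(1,2) by blast
        qed
        have F: "antichain_in Y (\<Union>k\<in>K. level (h k) (?D (g k)))"
          "|SIGMA k:K. level (h k) (?D (g k))| \<le>o |\<Union>k\<in>K. level (h k) (?D (g k))|"
          using antichain_UN[of K "\<lambda>k. ?D (g k)" "\<lambda>k. level (h k) (?D (g k))" Y] a d DY gS(1)
          by simp_all
        \<comment> \<open>Each level of \<open>?Z\<close> is replaced by an antichain at least as
          large inside its own set \<open>?D (g k)\<close>, so the sum of all levels fits into one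
          antichain.\<close>
        have "|B0| \<le>o |\<Union>k\<in>K. level k ?Z|"
          by (rule not_small[OF big[OF i0] cone_base_levels[OF Zopn K(1)]])
        also have "|\<Union>k\<in>K. level k ?Z| \<le>o |SIGMA k:K. level (h k) (?D (g k))|"
          by (rule UN_card_le) (rule h(2))
        also note F(2)
        finally show ?thesis by (rule attainedY[OF F(1)])
      qed
    qed
  qed
qed

text \<open>Well-founded induction on the size of a base, with the open set left arbitrary. It
  starts from the base formed by the cones of all levels.\<close>

theorem cone_open_attained:
  assumes "cone_open Y"
  shows "attained Y"
proof -
  have wf: "wf (inv_image ordLess (\<lambda>B :: 'p set set. |B| ))"
    by (rule wf_inv_image[OF wf_ordLess])
  have "cone_open Y \<Longrightarrow> cone_base Y B \<Longrightarrow> attained Y" for B Y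
    using wf
  proof (induction B arbitrary: Y rule: wf_induct_rule)
    case (less B)
    show ?case
      by (rule attained_step[OF less.prems]) (use less.IH in \<open>simp add: inv_image_def\<close>)
  qed
  moreover have "cone_base Y (\<Union>k\<in>Field r. level k Y)"
    by (rule cone_base_levels[OF assms]) (use r_refl in \<open>auto simp: cofin_def\<close>)
  ultimately show ?thesis using assms by blast
qed

end

section \<open>Cellular families, bases and dense sets in arbitrary spaces\<close>

text \<open>A nonempty basic set chosen inside each member identifies that member, since the members
  are disjoint.\<close>

lemma cellular_le_base:
  assumes "cellular_family T F" "is_base T B"
  shows "|F| \<le>o |B|"
proof -
  have "\<exists>V\<in>B. V \<noteq> {} \<and> V \<subseteq> U" if "U \<in> F" for U
  proof -
    have "openin T U" "U \<noteq> {}" using assms(1) that unfolding cellular_family_def by blast+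
    then obtain x where "openin T U \<and> x \<in> U" by blast
    then obtain V where "V \<in> B" "x \<in> V" "V \<subseteq> U" using assms(2) unfolding is_base_def by meson
    then show ?thesis by blast
  qed
  then obtain f where f: "\<And>U. U \<in> F \<Longrightarrow> f U \<in> B \<and> f U \<noteq> {} \<and> f U \<subseteq> U" by metis
  have "inj_on f F"
  proof (rule inj_onI, rule ccontr)
    fix U V assume UV: "U \<in> F" "V \<in> F" "f U = f V" "U \<noteq> V"
    then have "disjnt U V" using assms(1) unfolding cellular_family_def pairwise_def by blast
    then show False using f[OF UV(1)] f[OF UV(2)] UV(3) unfolding disjnt_iff by auto
  qed
  then show ?thesis using card_of_ordLeqI f by metis
qed

lemma cellular_le_dense:
  assumes "cellular_family T F" "is_dense T D"
  shows "|F| \<le>o |D|"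
proof -
  have "\<exists>x\<in>D. x \<in> U" if "U \<in> F" for U
  proof -
    have U: "openin T U" "U \<noteq> {}" using assms that unfolding cellular_family_def by blast+
    then obtain y where "y \<in> U" "y \<in> T closure_of D"
      using assms(2) openin_subset unfolding is_dense_def by blast
    then show ?thesis using U unfolding in_closure_of by blast
  qed
  then obtain f where f: "\<And>U. U \<in> F \<Longrightarrow> f U \<in> D \<and> f U \<in> U" by metis
  have "inj_on f F"
  proof (rule inj_onI)
    fix U V assume "U \<in> F" "V \<in> F" "f U = f V"
    then show "U = V"
      using f[of U] f[of V] assms(1) unfolding cellular_family_def pairwise_def disjnt_iff by metis
  qed
  then show ?thesis using card_of_ordLeqI f by metis
qed

lemma dense_from_base:
  assumes "is_base T B"
  obtains D where "is_dense T D" "|D| \<le>o |B|"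
proof -
  let ?D = "(\<lambda>V. SOME x. x \<in> V) ` (B - {{}})"
  have mem: "(SOME x. x \<in> V) \<in> V" if "V \<noteq> {}" for V :: "'a set"
    using that by (simp add: some_in_eq)
  have sub: "?D \<subseteq> topspace T"
  proof
    fix x assume "x \<in> ?D"
    then obtain V where V: "V \<in> B" "V \<noteq> {}" "x = (SOME x. x \<in> V)" by blast
    then have "openin T V" using assms unfolding is_base_def by simp
    then show "x \<in> topspace T" using mem[OF V(2)] openin_subset V(3) by blast
  qed
  have "y \<in> T closure_of ?D" if "y \<in> topspace T" for y
    unfolding in_closure_of
  proof (intro conjI allI impI)
    fix U assume "y \<in> U \<and> openin T U"
    then obtain V where V: "V \<in> B" "y \<in> V" "V \<subseteq> U" using assms unfolding is_base_def by meson
    then have "(SOME x. x \<in> V) \<in> ?D" "(SOME x. x \<in> V) \<in> U" using mem[of V] by auto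
    then show "\<exists>z. z \<in> ?D \<and> z \<in> U" by blast
  qed (use that in blast)
  then have "is_dense T ?D"
    using sub closure_of_subset_topspace[of T ?D] unfolding is_dense_def by fast
  moreover have "|?D| \<le>o |B|"
    by (rule ordLeq_transitive[OF card_of_image card_of_mono1]) blast
  ultimately show ?thesis using that by blast
qed

text \<open>Each of the three cardinals is at least \<open>|F|\<close> and at most
  \<open>|B|\<close>, so the hypothesis \<open>|B| \<le>o |F|\<close> closes the circle. Comparing
  with \<open>|F|\<close> also bridges the different types on which they live.\<close>

lemma cardinal_functions_eq:
  fixes T :: "'p topology"
  assumes B: "is_base T B" and F: "cellular_family T F" and le: "|B| \<le>o |F|"
  shows "top_weight T =o |F|" "top_density T =o |F|" "top_cellularity T =o |F|"
proof -
  obtain B1 where B1: "is_base T B1" "top_weight T = |B1|" using top_weight(1) by blast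
  show "top_weight T =o |F|"
    using ordLeq_transitive[OF top_weight(2)[OF B] le] cellular_le_base[OF F B1(1)] B1(2)
    by (simp add: ordIso_iff_ordLeq)
  obtain D1 where D1: "is_dense T D1" "top_density T = |D1|" using top_density(1) by blast
  obtain D where D: "is_dense T D" "|D| \<le>o |B|" using dense_from_base[OF B] by blast
  have "top_density T \<le>o |F|"
    by (rule ordLeq_transitive[OF ordLeq_transitive[OF top_density(2)[OF D(1)] D(2)] le])
  then show "top_density T =o |F|"
    using cellular_le_dense[OF F D1(1)] D1(2) by (simp add: ordIso_iff_ordLeq)
  have "top_cellularity T \<le>o |F|"
    by (rule top_cellularity(3)[OF card_of_Card_order])
      (rule ordLeq_transitive[OF cellular_le_base[OF _ B] le])
  then show "top_cellularity T =o |F|"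
    using top_cellularity(2)[OF F] by (simp add: ordIso_iff_ordLeq)
qed

section \<open>Initial segments and the bounded topology\<close>

lemma seqs_agree:
  assumes "x \<in> seqs I A" "y \<in> seqs I A" "J \<subseteq> I"
  shows "x |` J \<subseteq>\<^sub>m y \<longleftrightarrow> (\<forall>j\<in>J. x j = y j)"
proof -
  have "dom (x |` J) = J" using assms unfolding seqs_def by auto
  then show ?thesis unfolding map_le_def by auto
qed

lemma restrict_seqs_below:
  assumes "x \<in> seqs (Field r) A" "i \<in> Field r"
  shows "x |` underS r i \<in> seqs_below r A"
proof -
  have "underS r i \<subseteq> Field r" unfolding underS_def Field_def by auto
  then have "x |` underS r i \<in> seqs (underS r i) A"
    using assms(1) unfolding seqs_def
    by (auto simp: ran_def restrict_map_def dom_def split: if_splits)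
  then show ?thesis using assms(2) unfolding seqs_below_def by blast
qed

text \<open>A sequence contained in \<open>x\<close> is determined by its domain, so the cones
  containing \<open>x\<close> are indexed by lengths alone.\<close>

lemma seqs_below_restrict:
  assumes "s \<in> seqs_below r A" "s \<subseteq>\<^sub>m x"
  obtains i where "i \<in> Field r" "s = x |` underS r i"
proof -
  obtain i where i: "i \<in> Field r" "dom s = underS r i"
    using assms(1) unfolding seqs_below_def seqs_def by blast
  have "s j = (x |` underS r i) j" for j
    using assms(2) i(2) unfolding map_le_def restrict_map_def by (cases "j \<in> dom s") auto
  then show ?thesis using that i by blast
qed

text \<open>The cones around a point are nested, so finite intersections of generators give nothing
  smaller than a cone. For \<gamma> = 0 the equivalence fails: the one-point space is open, but
  there is no index.\<close>

lemma openin_bounded_topology: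
  assumes ne: "Field r \<noteq> {}" and r: "Well_order r"
  shows "openin (bounded_topology r A) U \<longleftrightarrow> U \<subseteq> seqs (Field r) A \<and>
    (\<forall>x\<in>U. \<exists>i\<in>Field r. seq_cone r A (x |` underS r i) \<subseteq> U)" (is "?L \<longleftrightarrow> ?R")
proof
  let ?S = "seqs (Field r) A"
  let ?G = "insert ?S (seq_cone r A ` seqs_below r A)"
  assume ?L
  then have "generate_topology_on ?G U"
    unfolding bounded_topology_def by (simp add: openin_topology_generated_by_iff)
  then show ?R
  proof induction
    case Empty
    then show ?case by simp
  next
    case (Int U V)
    have "\<exists>k\<in>Field r. seq_cone r A (x |` underS r k) \<subseteq> U \<inter> V" if x: "x \<in> U \<inter> V" for x
    proof -
      obtain i j where ij: "i \<in> Field r" "seq_cone r A (x |` underS r i) \<subseteq> U"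
        "j \<in> Field r" "seq_cone r A (x |` underS r j) \<subseteq> V" using Int x by blast
      \<comment> \<open>A longer initial segment has a smaller cone, so the later of the two indices
        works for the intersection.\<close>
      have mono: "seq_cone r A (x |` underS r l) \<subseteq> seq_cone r A (x |` underS r k)"
        if "(k, l) \<in> r" for k l
      proof -
        have "underS r k \<subseteq> underS r l"
          using that r underS_incr[of r k l] by (auto simp: order_on_defs)
        then have "x |` underS r k \<subseteq>\<^sub>m x |` underS r l"
          by (auto simp: map_le_def restrict_map_def)
        then show ?thesis unfolding seq_cone_def using map_le_trans by blast
      qed
      have "(i, j) \<in> r \<or> (j, i) \<in> r"
        using ij r wo_rel.TOTALS[of r] by (auto simp: wo_rel_def)
      then show ?thesis using ij mono by blast
    qed
    then show ?case using Int by blast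
  next
    case (UN \<U>)
    then show ?case by blast
  next
    case (Basis U)
    then consider "U = ?S" | s where "s \<in> seqs_below r A" "U = seq_cone r A s" by blast
    then show ?case
    proof cases
      case 1
      then show ?thesis using ne unfolding seq_cone_def by blast
    next
      case 2
      have "\<exists>i\<in>Field r. seq_cone r A (x |` underS r i) \<subseteq> U" if "x \<in> U" for x
        using seqs_below_restrict[OF 2(1), of x] that 2(2) unfolding seq_cone_def by blast
      then show ?thesis using 2 unfolding seq_cone_def by blast
    qed
  qed
next
  assume R: ?R
  let ?c = "\<lambda>x i. seq_cone r A (x |` underS r i)"
  have op: "openin (bounded_topology r A) (?c x i)" if "x \<in> U" "i \<in> Field r" for x i
  proof -
    have "x \<in> seqs (Field r) A" using R that(1) by blast
    then show ?thesis
      unfolding bounded_topology_def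
      by (intro topology_generated_by_Basis insertI2 imageI restrict_seqs_below that(2))
  qed
  have mem: "x \<in> ?c x i" if "x \<in> U" for x i
    using R that unfolding seq_cone_def by (auto simp: map_le_def restrict_map_def)
  show ?L
  proof (subst openin_subopen, intro ballI)
    fix x assume x: "x \<in> U"
    then obtain i where "i \<in> Field r" "?c x i \<subseteq> U" using R by blast
    then show "\<exists>T. openin (bounded_topology r A) T \<and> x \<in> T \<and> T \<subseteq> U"
      using op[OF x] mem[OF x] by blast
  qed
qed

section \<open>Spaces of sequences\<close>

text \<open>The condition \<open>Field r \<noteq> {} \<or> X = {}\<close> excludes only the
  one-point space with \<gamma> = 0: there are no sequences of length below 0, so its canonical
  basis is empty although its weight is 1.\<close>

theorem proposition2p3:
  fixes r :: "'i rel" and A :: "'a set" and X :: "('i \<rightharpoonup> 'a) set"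
    and T :: "('i \<rightharpoonup> 'a) topology" and lam :: "'c rel"
  assumes "Well_order r" and "X \<subseteq> seqs (Field r) A"
    and "T = subtopology (bounded_topology r A) X"
  shows "(top_weight T =o lam \<and> (Field r \<noteq> {} \<or> X = {}) \<longrightarrow>
            (\<exists>F. F \<subseteq> canonical_basis r A X \<and> pairwise disjnt F \<and> |F| =o lam)) \<and>
         top_cellularity T =o top_density T \<and> top_density T =o top_weight T"
proof -
  have "\<exists>B F. is_base T B \<and> cellular_family T F \<and> |B| \<le>o |F| \<and>
          (Field r \<noteq> {} \<or> X = {} \<longrightarrow> F \<subseteq> canonical_basis r A X)"
  proof (cases "Field r = {}")
    case True
    have top: "topspace T = X"
      using assms(2) unfolding assms(3) bounded_topology_def topspace_subtopology
        topology_generated_by_topspace by blast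
    have "X \<subseteq> {Map.empty}" using assms(2) True unfolding seqs_def by auto
    then have "U = X" if "openin T U" "x \<in> U" for U x
      using openin_subset[OF that(1)] that(2) top by blast
    moreover have "openin T X" using top openin_topspace by metis
    \<comment> \<open>For \<gamma> = 0 the space has at most one point, and one family is both base
      and cellular. Removing the empty set covers the case that \<open>X\<close> is empty.\<close>
    ultimately have "is_base T ({X} - {{}})" "cellular_family T ({X} - {{}})"
      unfolding is_base_def cellular_family_def by (auto simp: pairwise_def)
    then show ?thesis using True card_of_mono1 by (intro exI[of _ "{X} - {{}}"]) auto
  next
    case False
    define N where "N i x = seq_cone r A (x |` underS r i) \<inter> X" for i x
    have us: "underS r i \<subseteq> Field r" for i unfolding underS_def Field_def by auto
    \<comment> \<open>Described as agreement below \<open>i\<close>, the sets \<open>N i x\<close>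
      visibly satisfy the axioms of nested partitions.\<close>
    have N: "N i x = {y \<in> X. \<forall>j\<in>underS r i. x j = y j}" if "x \<in> X" for i x
      using that assms(2) seqs_agree[OF _ _ us] unfolding N_def seq_cone_def by blast
    interpret nested_partitions r X N
    proof
      fix i j x assume "(i, j) \<in> r" "x \<in> X"
      moreover have "underS r i \<subseteq> underS r j"
        using calculation assms(1) underS_incr[of r i j] by (auto simp: order_on_defs)
      ultimately show "N j x \<subseteq> N i x" using N by auto
    qed (use assms(1) N in auto)
    \<comment> \<open>If a basic clopen set contains \<open>x\<close>, its defining sequence is an
      initial segment of \<open>x\<close>; so antichains of cones are families of basic clopen
      sets.\<close>
    have cb: "cones X = canonical_basis r A X"
    proof
      show "cones X \<subseteq> canonical_basis r A X"
        using assms(2) restrict_seqs_below N_refl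
        unfolding cones_def canonical_basis_def N_def by fast
      show "canonical_basis r A X \<subseteq> cones X"
      proof
        fix V assume "V \<in> canonical_basis r A X"
        then obtain s x where s: "s \<in> seqs_below r A" "V = seq_cone r A s \<inter> X" "x \<in> V"
          unfolding canonical_basis_def by blast
        then obtain i where "i \<in> Field r" "s = x |` underS r i"
          using seqs_below_restrict unfolding seq_cone_def by blast
        then show "V \<in> cones X" using s unfolding cones_def N_def by blast
      qed
    qed
    have op: "\<exists>i\<in>Field r. N i x \<subseteq> U" if U: "openin T U" "x \<in> U" for U x
    proof -
      obtain W where "openin (bounded_topology r A) W" "U = W \<inter> X"
        using U(1) unfolding assms(3) openin_subtopology by blast
      then have "\<exists>i\<in>Field r. seq_cone r A (x |` underS r i) \<subseteq> W"
        using U(2) openin_bounded_topology[OF False assms(1), of A W] by simp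
      then show ?thesis unfolding N_def \<open>U = W \<inter> X\<close> by blast
    qed
    have op_cone: "openin T V" if V: "V \<in> cones X" for V
    proof -
      obtain s where "s \<in> seqs_below r A" "V = seq_cone r A s \<inter> X"
        using V unfolding cb canonical_basis_def by blast
      moreover from this have "openin (bounded_topology r A) (seq_cone r A s)"
        unfolding bounded_topology_def
        by (intro topology_generated_by_Basis insertI2 imageI)
      ultimately show ?thesis unfolding assms(3) openin_subtopology by blast
    qed
    have "attained X" by (rule cone_open_attained) (use False N_sub in \<open>auto simp: cone_open_def\<close>)
    then obtain B F where BF: "cone_base X B" "antichain_in X F" "|B| \<le>o |F|" unfolding attained_def by blast
    have "is_base T B"
      unfolding is_base_def
    proof (intro conjI allI impI ballI)
      show "openin T V" if "V \<in> B" for V using BF(1) that op_cone unfolding cone_base_def by blast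
      fix U x assume U: "openin T U \<and> x \<in> U"
      then have "x \<in> X" using openin_subset unfolding assms(3) by fastforce
      then show "\<exists>V\<in>B. x \<in> V \<and> V \<subseteq> U"
      proof -
        obtain i where i: "i \<in> Field r" "N i x \<subseteq> U" using op U by blast
        then obtain V where "V \<in> B" "x \<in> V" "V \<subseteq> N i x"
          using BF(1) \<open>x \<in> X\<close> unfolding cone_base_def by meson
        then show ?thesis using i(2) by blast
      qed
    qed
    moreover have "cellular_family T F" "F \<subseteq> cones X"
    proof -
      show "F \<subseteq> cones X" using BF(2) unfolding antichain_in_def by blast
      then have "openin T V" "V \<noteq> {}" if "V \<in> F" for V
        using op_cone cones_nonempty that by blast+
      then show "cellular_family T F" using BF(2) unfolding cellular_family_def antichain_in_def by blast
    qed
    ultimately show ?thesis using BF(3) unfolding cb by meson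
  qed
  then obtain B F where BF: "is_base T B" "cellular_family T F" "|B| \<le>o |F|"
    "Field r \<noteq> {} \<or> X = {} \<longrightarrow> F \<subseteq> canonical_basis r A X" by blast
  note eq = cardinal_functions_eq[OF BF(1-3)]
  show ?thesis
  proof (intro conjI impI)
    assume "top_weight T =o lam \<and> (Field r \<noteq> {} \<or> X = {})"
    then show "\<exists>F. F \<subseteq> canonical_basis r A X \<and> pairwise disjnt F \<and> |F| =o lam"
      using BF(2,4) ordIso_transitive[OF ordIso_symmetric[OF eq(1)]] unfolding cellular_family_def by blast
  qed (rule ordIso_transitive[OF eq(3) ordIso_symmetric[OF eq(2)]]
      ordIso_transitive[OF eq(2) ordIso_symmetric[OF eq(1)]])+
qed

end
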